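(* Let $E$ be any locally compact, Hausdorff, second countable topological space with $|E|>1$. Then there exist constants $0<c_1,c_2<\infty$ such that for every integer $m\ge 1$, $$\frac{c_2}{m}\le \psi_m\le\frac{c_1}{m},$$ where $$\psi_m:=\sup_{\mathcal X\in\mathcal D_m}\ \inf_{\mathcal Y\in\mathcal D_\infty} d_V(\mathcal X,\mathcal Y),\qquad d_V(\mathcal X,\mathcal Y):=\sup_{K\in\mathcal K}\left|V_{\mathcal X}(K)-V_{\mathcal Y}(K)\right|.$$
   Context: $\mathcal F$ and $\mathcal K$ denote the collections of closed and of compact subsets of $E$, respectively. $\mathcal F$ is equipped with the Fell topology (generated by the sets $\{F\in\mathcal F:F\cap K=\emptyset\}$, $K$ compact, and $\{F\in\mathcal F:F\cap G\ne\emptyset\}$, $G$ open) and its Borel $\sigma$-algebra. A random (closed) set in $E$ is a random variable $\mathcal X$ with values in $\mathcal F$, measurable with respect to this $\sigma$-algebra (the empty set is allowed as a value). Its void functional is $V_{\mathcal X}(K):=\mathbb P\{\mathcal X\cap K=\emptyset\}$, $K\in\mathcal K$. A random set $\mathcal X$ is $m$-divisible (for union) if there exist i.i.d. random sets $\mathcal X_{m,1},\ldots,\mathcal X_{m,m}$ such that $\mathcal X$ has the same distribution as $\mathcal X_{m,1}\cup\cdots\cup\mathcal X_{m,m}$; it is infinitely divisible if it is $m$-divisible for every integer $m\ge1$. $\mathcal D_m$ is the set of all $m$-divisible random sets in $E$, and $\mathcal D_\infty$ is the set of all infinitely divisible random sets in $E$. *)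

theory Defs
  imports "HOL-Probability.Probability"
begin

definition fell_topology :: "'a::topological_space set topology" where
  "fell_topology = topology_generated_by
     ({{F. closed F \<and> F \<inter> K = {}} |K. compact K} \<union> {{F. closed F \<and> F \<inter> G \<noteq> {}} |G. open G})"

lemma topspace_fell_topology: "topspace fell_topology = {F. closed F}"
proof (rule set_eqI)
  fix F :: "'a set"
  show "F \<in> topspace fell_topology \<longleftrightarrow> F \<in> {F. closed F}"
  proof
    assume "F \<in> topspace fell_topology"
    then show "F \<in> {F. closed F}"
      unfolding fell_topology_def topology_generated_by_topspace by auto
  next
    assume "F \<in> {F. closed F}"
    then have "F \<in> {F. closed F \<and> F \<inter> {} = {}}" by simp
    moreover have "{F. closed F \<and> F \<inter> {} = {}} \<in> {{F::'a set. closed F \<and> F \<inter> K = {}} |K. compact K}"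
      by (intro CollectI exI[of _ "{}"] conjI refl compact_empty)
    ultimately show "F \<in> topspace fell_topology"
      unfolding fell_topology_def topology_generated_by_topspace by (meson UnI1 UnionI)
  qed
qed

definition fell_borel :: "'a::topological_space set measure" where
  "fell_borel = sigma (topspace fell_topology) {U. openin fell_topology U}"

definition random_set :: "'w measure \<Rightarrow> ('w \<Rightarrow> 'a::topological_space set) \<Rightarrow> bool" where
  "random_set M X \<longleftrightarrow> prob_space M \<and> X \<in> M \<rightarrow>\<^sub>M fell_borel"

definition void_functional :: "'w measure \<Rightarrow> ('w \<Rightarrow> 'a::topological_space set) \<Rightarrow> 'a set \<Rightarrow> real" where
  "void_functional M X K = measure M {\<omega> \<in> space M. X \<omega> \<inter> K = {}}"

text \<open>
  HOL cannot quantify over the type of the sample space, so the existentially chosen random sets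
  live on probability spaces over the single type \<open>nat \<Rightarrow> 'a set\<close>. By the following lemma every
  joint law of a sequence of random sets already occurs on that type, so nothing is lost.
\<close>

type_synonym 'a sample = "nat \<Rightarrow> 'a set"

lemma joint_law_on_sample:
  fixes M :: "'w measure" and Y :: "nat \<Rightarrow> 'w \<Rightarrow> 'a::topological_space set"
  assumes "prob_space M" and Y: "\<And>i. i \<in> I \<Longrightarrow> random_set M (Y i)"
  shows "\<exists>(N :: 'a sample measure) Z. prob_space N \<and> (\<forall>i\<in>I. random_set N (Z i)) \<and>
    distr N (PiM I (\<lambda>_. fell_borel)) (\<lambda>\<omega>. \<lambda>i\<in>I. Z i \<omega>) =
    distr M (PiM I (\<lambda>_. fell_borel)) (\<lambda>\<omega>. \<lambda>i\<in>I. Y i \<omega>)"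
proof -
  let ?P = "PiM I (\<lambda>_. fell_borel :: 'a set measure)"
  let ?N = "distr M ?P (\<lambda>\<omega>. \<lambda>i\<in>I. Y i \<omega>)"
  have meas: "(\<lambda>\<omega>. \<lambda>i\<in>I. Y i \<omega>) \<in> M \<rightarrow>\<^sub>M ?P"
    using Y by (intro measurable_restrict) (simp add: random_set_def)
  have N: "prob_space ?N"
    using prob_space.prob_space_distr[OF assms(1) meas] .
  have "random_set ?N (\<lambda>\<omega>. \<omega> i)" if "i \<in> I" for i
    using N that by (simp add: random_set_def)
  moreover have "distr ?N ?P (\<lambda>\<omega>. \<lambda>i\<in>I. \<omega> i) = distr ?N ?P (\<lambda>\<omega>. \<omega>)"
    by (intro distr_cong) (auto simp: space_PiM)
  ultimately show ?thesis
    using N by (intro exI[of _ ?N] exI[of _ "\<lambda>i \<omega>. \<omega> i"]) (simp add: distr_id2)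
qed

definition divisible :: "nat \<Rightarrow> 'w measure \<Rightarrow> ('w \<Rightarrow> 'a::topological_space set) \<Rightarrow> bool" where
  "divisible m M X \<longleftrightarrow>
     (\<exists>(N :: 'a sample measure) Y.
        prob_space N \<and> (\<forall>i\<in>{1..m}. random_set N (Y i)) \<and>
        prob_space.indep_vars N (\<lambda>_. fell_borel) Y {1..m} \<and>
        (\<forall>i\<in>{1..m}. \<forall>j\<in>{1..m}. distr N fell_borel (Y i) = distr N fell_borel (Y j)) \<and>
        distr M fell_borel X = distr N fell_borel (\<lambda>\<omega>. \<Union>i\<in>{1..m}. Y i \<omega>))"

definition infinitely_divisible :: "'w measure \<Rightarrow> ('w \<Rightarrow> 'a::topological_space set) \<Rightarrow> bool" where
  "infinitely_divisible M X \<longleftrightarrow> (\<forall>m\<ge>1. divisible m M X)"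

type_synonym 'a rset = "'a sample measure \<times> ('a sample \<Rightarrow> 'a set)"

definition D :: "nat \<Rightarrow> 'a::topological_space rset set" where
  "D m = {(M, X). random_set M X \<and> divisible m M X}"

definition D_inf :: "'a::topological_space rset set" where
  "D_inf = {(M, X). random_set M X \<and> infinitely_divisible M X}"

definition d_V :: "'a::topological_space rset \<Rightarrow> 'a rset \<Rightarrow> real" where
  "d_V = (\<lambda>(M, X) (N, Y). SUP K\<in>{K. compact K}. \<bar>void_functional M X K - void_functional N Y K\<bar>)"

text \<open>
  The suprema and infima are over nonempty families of reals in \<open>[0, 1]\<close> (for \<open>m \<ge> 1\<close>), so their
  unspecified values on unbounded or empty sets play no role.
\<close>

definition psi :: "'a::topological_space itself \<Rightarrow> nat \<Rightarrow> real" where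
  "psi _ m = (SUP X \<in> (D m :: 'a rset set). INF Y \<in> (D_inf :: 'a rset set). d_V X Y)"

end

theory Submission imports Defs begin

text \<open>
  Everything is read off from void functionals. In a locally compact, Hausdorff, second countable
  space the Fell topology has a countable base of sets built from the events "\<open>F\<close> misses \<open>K\<close>" with
  \<open>K\<close> compact, so these events generate the Borel \<open>\<sigma>\<close>-algebra (\<open>sets_fell_borel\<close>), and since they are
  closed under intersection, the void functional determines the law
  (\<open>distr_eq_iff_void_functional\<close>). The void functional of a union of independent random sets is the
  product of theirs. Hence \<open>X\<close> is \<open>m\<close>-divisible if and only if \<open>V\<^sub>X = V\<^sub>R ^ m\<close> on compact sets for some
  random set \<open>R\<close> (\<open>divisible_iff_void_functional_root\<close>).

  Upper bound: given such a root \<open>R\<close> of \<open>X\<close>, the union of a Poisson number, of mean \<open>m\<close>, of independent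
  copies of \<open>R\<close> has void functional \<open>exp (- m (1 - V\<^sub>R))\<close>. Its \<open>n\<close>-th root is the same expression with
  mean \<open>m / n\<close>, so it is infinitely divisible
  (\<open>ex_infinitely_divisible_compound_poisson\<close>). It remains to compare \<open>v ^ m\<close> with
  \<open>exp (- m (1 - v))\<close> for \<open>v\<close> in the unit interval; they differ by at most \<open>2 / m\<close>
  (\<open>exp_minus_power_bounds\<close>).

  Lower bound: an infinitely divisible random set avoids \<open>K\<close> and \<open>L\<close> with nonnegative correlation,
  \<open>V(K) V(L) \<le> V(K \<union> L)\<close> (\<open>infinitely_divisible_void_functional_Un\<close>). Take two points \<open>x\<close>, \<open>y\<close> and a
  random set that is \<open>{x}\<close> or \<open>{y}\<close> with probability \<open>p = 1 / (4 m)\<close> each and empty otherwise. For the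
  union of \<open>m\<close> independent copies the events of missing \<open>x\<close> and of missing \<open>y\<close> are negatively
  correlated, with defect \<open>(1 - p) ^ (2 m) - (1 - 2 p) ^ m\<close>, which is of order \<open>m p\<^sup>2\<close>, that is \<open>1 / m\<close>
  (\<open>two_point_correlation_gap\<close>). Moving each of the three values of the void functional by at most
  \<open>d\<close> changes this defect by at most \<open>3 d\<close>, so no infinitely divisible set is closer than a constant
  times \<open>1 / m\<close>.
\<close>

section \<open>The Borel sets of the Fell topology\<close>

definition miss :: "'a::topological_space set \<Rightarrow> 'a set set" where
  "miss K = {F. closed F \<and> F \<inter> K = {}}"

lemma miss_Un: "miss K \<inter> miss L = miss (K \<union> L)"
  by (auto simp: miss_def)

text \<open>
  Second countability gives a countable base; local compactness and the Hausdorff property give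
  regularity, by which the members with compact closure still form a base, with closures as small
  as desired.
\<close>

lemma countable_precompact_base:
  assumes lc: "locally_compact_space (euclidean :: 'a::{t2_space, second_countable_topology} topology)"
  obtains \<B> :: "'a::{t2_space, second_countable_topology} set set" where "countable \<B>"
    and "\<And>B. B \<in> \<B> \<Longrightarrow> open B \<and> compact (closure B)"
    and "\<And>x G. open G \<Longrightarrow> x \<in> G \<Longrightarrow> \<exists>B\<in>\<B>. x \<in> B \<and> closure B \<subseteq> G"
proof -
  obtain \<A> :: "'a set set" where \<A>: "countable \<A>" "topological_basis \<A>"
    using ex_countable_basis by blast
  have hausdorff_euclidean: "Hausdorff_space (euclidean :: 'a topology)"
    unfolding Hausdorff_space_def disjnt_def by (simp, metis hausdorff)
  have nb: "neighbourhood_base_of (\<lambda>C. compactin euclidean C \<and> closedin euclidean C)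
      (euclidean :: 'a topology)"
    by (rule iffD1[OF locally_compact_regular_space_neighbourhood_base])
      (use lc locally_compact_Hausdorff_imp_regular_space[OF lc] hausdorff_euclidean in blast)
  let ?\<B> = "{B \<in> \<A>. compact (closure B)}"
  have "\<exists>B\<in>?\<B>. x \<in> B \<and> closure B \<subseteq> G" if G: "open G" "x \<in> G" for x :: 'a and G
  proof -
    obtain U C where UC: "open U" "compact C" "closed C" "x \<in> U" "U \<subseteq> C" "C \<subseteq> G"
      using nb[unfolded neighbourhood_base_of, rule_format, of G x] G by auto
    obtain B where B: "B \<in> \<A>" "x \<in> B" "B \<subseteq> U"
      using topological_basisE[OF \<A>(2) UC(1,4)] by blast
    have sub: "closure B \<subseteq> C"
      using B UC by (intro closure_minimal) auto
    then have "compact (closure B)"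
      using UC(2) by (metis closed_closure compact_Int_closed inf.absorb_iff2)
    with B sub UC show ?thesis by blast
  qed
  then show ?thesis
    using \<A> by (intro that[of ?\<B>]) (auto simp: topological_basis_open)
qed

context
  assumes lc: "locally_compact_space (euclidean :: 'a::{t2_space, second_countable_topology} topology)"
begin

text \<open>
  An open set is a countable union of compact sets, and a set hits \<open>G\<close> if and only if it hits one of
  them.
\<close>

lemma hit_open_generated:
  assumes "open (G :: 'a set)"
  shows "{F. closed F \<and> F \<inter> G \<noteq> {}} \<in> sigma_sets {F. closed F} {miss K |K. compact K}"
proof -
  obtain \<B> :: "'a set set" where \<B>: "countable \<B>" "\<And>B. B \<in> \<B> \<Longrightarrow> open B \<and> compact (closure B)"
    "\<And>x G. open G \<Longrightarrow> x \<in> G \<Longrightarrow> \<exists>B\<in>\<B>. x \<in> B \<and> closure B \<subseteq> G"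
    using countable_precompact_base[OF lc] by blast
  interpret sigma_algebra "{F::'a set. closed F}" "sigma_sets {F. closed F} {miss K |K. compact K}"
    by (rule sigma_algebra_sigma_sets) (auto simp: miss_def)
  let ?C = "{B \<in> \<B>. closure B \<subseteq> G}"
  have "{F. closed F \<and> F \<inter> G \<noteq> {}} = (\<Union>B\<in>?C. {F. closed F} - miss (closure B))"
  proof (intro equalityI subsetI)
    fix F assume "F \<in> {F. closed F \<and> F \<inter> G \<noteq> {}}"
    then obtain x where x: "closed F" "x \<in> F" "x \<in> G" by auto
    from \<B>(3)[OF assms x(3)] obtain B where "B \<in> ?C" "x \<in> B" by blast
    with x show "F \<in> (\<Union>B\<in>?C. {F. closed F} - miss (closure B))"
      using closure_subset[of B] by (auto simp: miss_def)
  qed (auto simp: miss_def)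
  also have "\<dots> \<in> sigma_sets {F. closed F} {miss K |K. compact K}"
  proof (rule countable_UN'')
    show "countable ?C" using \<B>(1) by simp
  next
    fix B assume "B \<in> ?C"
    then have "miss (closure B) \<in> sigma_sets {F. closed F} {miss K |K. compact K}"
      using \<B>(2) by (intro sigma_sets.Basic) blast
    with top show "{F. closed F} - miss (closure B) \<in> sigma_sets {F. closed F} {miss K |K. compact K}"
      by (rule Diff)
  qed
  finally show ?thesis .
qed

text \<open>
  The generating sets of the Fell topology are uncountably many, and unions of open sets are
  arbitrary, so membership in a \<open>\<sigma>\<close>-algebra does not pass along the generation of the topology. A
  countable base repairs this: finite intersections of conditions "misses the closure of \<open>B\<close>" and
  "hits \<open>B\<close>", with \<open>B\<close> from a countable base of \<open>E\<close>, suffice.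
\<close>

lemma fell_topology_countable_base:
  obtains \<W> :: "'a set set set" where "countable \<W>"
    and "\<W> \<subseteq> sigma_sets {F. closed F} {miss K |K. compact K}"
    and "\<And>U F. openin fell_topology U \<Longrightarrow> F \<in> U \<Longrightarrow> \<exists>W\<in>\<W>. F \<in> W \<and> W \<subseteq> U"
proof -
  obtain \<B> :: "'a set set" where \<B>: "countable \<B>" "\<And>B. B \<in> \<B> \<Longrightarrow> open B \<and> compact (closure B)"
    "\<And>x G. open G \<Longrightarrow> x \<in> G \<Longrightarrow> \<exists>B\<in>\<B>. x \<in> B \<and> closure B \<subseteq> G"
    using countable_precompact_base[OF lc] by blast
  interpret S: sigma_algebra "{F::'a set. closed F}" "sigma_sets {F. closed F} {miss K |K. compact K}"
    by (rule sigma_algebra_sigma_sets) (auto simp: miss_def)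
  define \<C> :: "'a set set set" where
    "\<C> = (\<lambda>B. miss (closure B)) ` \<B> \<union> (\<lambda>B. {F. closed F \<and> F \<inter> B \<noteq> {}}) ` \<B>"
  \<comment> \<open>Intersecting with the closed sets makes \<open>W {}\<close> the whole space.\<close>
  define W :: "'a set set set \<Rightarrow> 'a set set" where "W J = {F. closed F} \<inter> \<Inter>J" for J
  have W_Un: "W (I \<union> J) = W I \<inter> W J" for I J
    by (auto simp: W_def)
  have \<C>_sets: "\<C> \<subseteq> sigma_sets {F. closed F} {miss K |K. compact K}"
  proof -
    have "miss (closure B) \<in> sigma_sets {F. closed F} {miss K |K. compact K}" if "B \<in> \<B>" for B
      using \<B>(2)[OF that] by (intro sigma_sets.Basic) blast
    then show ?thesis
      unfolding \<C>_def using \<B>(2) hit_open_generated by blast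
  qed
  have W_sets: "W J \<in> sigma_sets {F. closed F} {miss K |K. compact K}"
    if "finite J" "J \<subseteq> \<C>" for J
    using that
  proof (induction J)
    case empty
    then show ?case by (simp add: W_def S.top)
  next
    case (insert A J)
    then have "A \<in> sigma_sets {F. closed F} {miss K |K. compact K}"
      and "W J \<in> sigma_sets {F. closed F} {miss K |K. compact K}"
      using \<C>_sets by blast+
    then have "A \<inter> W J \<in> sigma_sets {F. closed F} {miss K |K. compact K}"
      by (rule S.Int)
    also have "A \<inter> W J = W (insert A J)" by (auto simp: W_def)
    finally show ?case .
  qed
  have base: "\<exists>J. finite J \<and> J \<subseteq> \<C> \<and> F \<in> W J \<and> W J \<subseteq> U"
    if "openin fell_topology U" "F \<in> U" for U F
  proof -
    from that(1) have "generate_topology_on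
      ({{F::'a set. closed F \<and> F \<inter> K = {}} |K. compact K} \<union> {{F. closed F \<and> F \<inter> G \<noteq> {}} |G. open G}) U"
      unfolding fell_topology_def by (rule openin_topology_generated_by)
    then have "\<forall>F\<in>U. \<exists>J. finite J \<and> J \<subseteq> \<C> \<and> F \<in> W J \<and> W J \<subseteq> U"
    proof induction
      case Empty
      then show ?case by simp
    next
      case (Int a b)
      show ?case
      proof
        fix F assume "F \<in> a \<inter> b"
        then have F: "F \<in> a" "F \<in> b" by auto
        obtain I where "finite I" "I \<subseteq> \<C>" "F \<in> W I" "W I \<subseteq> a"
          using bspec[OF Int.IH(1) F(1)] by blast
        moreover obtain J where "finite J" "J \<subseteq> \<C>" "F \<in> W J" "W J \<subseteq> b"
          using bspec[OF Int.IH(2) F(2)] by blast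
        ultimately show "\<exists>J. finite J \<and> J \<subseteq> \<C> \<and> F \<in> W J \<and> W J \<subseteq> a \<inter> b"
          by (intro exI[of _ "I \<union> J"]) (auto simp: W_Un)
      qed
    next
      case (UN K)
      show ?case
      proof
        fix F assume "F \<in> \<Union>K"
        then obtain k where k: "k \<in> K" "F \<in> k" by blast
        obtain J where "finite J" "J \<subseteq> \<C>" "F \<in> W J" "W J \<subseteq> k"
          using bspec[OF UN.IH[OF k(1)] k(2)] by blast
        with k(1) show "\<exists>J. finite J \<and> J \<subseteq> \<C> \<and> F \<in> W J \<and> W J \<subseteq> \<Union>K"
          by blast
      qed
    next
      case (Basis s)
      then consider K where "compact K" "s = {F. closed F \<and> F \<inter> K = {}}"
        | G where "open G" "s = {F. closed F \<and> F \<inter> G \<noteq> {}}" by blast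
      then show ?case
      proof cases
        case 1
        show ?thesis
        proof
          fix F assume F: "F \<in> s"
          \<comment> \<open>Finitely many base sets whose closures miss \<open>F\<close> cover \<open>K\<close>.\<close>
          let ?D = "{B \<in> \<B>. closure B \<subseteq> - F}"
          have cover: "K \<subseteq> \<Union>?D"
          proof
            fix x assume "x \<in> K"
            with F 1 have "open (- F)" "x \<in> - F" by auto
            from \<B>(3)[OF this] show "x \<in> \<Union>?D" by blast
          qed
          have open_D: "open B" if "B \<in> ?D" for B
            using that \<B>(2) by simp
          obtain D where D: "D \<subseteq> ?D" "finite D" "K \<subseteq> \<Union>D"
            by (rule compactE[OF \<open>compact K\<close> cover open_D])
          let ?J = "(\<lambda>B. miss (closure B)) ` D"
          have "?J \<subseteq> \<C>" "finite ?J" using D by (auto simp: \<C>_def)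
          moreover have "F \<in> W ?J" using F 1 D by (auto simp: W_def miss_def)
          moreover have "W ?J \<subseteq> s"
          proof
            fix F' assume F': "F' \<in> W ?J"
            then have "F' \<inter> B = {}" if "B \<in> D" for B
              using that closure_subset[of B] by (auto simp: W_def miss_def)
            then have "F' \<inter> K = {}" using D(3) by blast
            with F' show "F' \<in> s" unfolding 1(2) by (simp add: W_def)
          qed
          ultimately show "\<exists>J. finite J \<and> J \<subseteq> \<C> \<and> F \<in> W J \<and> W J \<subseteq> s" by blast
        qed
      next
        case 2
        show ?thesis
        proof
          fix F assume F: "F \<in> s"
          then obtain x where x: "x \<in> F" "x \<in> G" using 2 by auto
          from \<B>(3)[OF 2(1) x(2)] obtain B where B: "B \<in> \<B>" "x \<in> B" "B \<subseteq> G"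
            using closure_subset by blast
          let ?J = "{{F. closed F \<and> F \<inter> B \<noteq> {}}}"
          have "?J \<subseteq> \<C>" using B by (auto simp: \<C>_def)
          moreover have "F \<in> W ?J" "W ?J \<subseteq> s" using B x F 2 by (auto simp: W_def)
          ultimately show "\<exists>J. finite J \<and> J \<subseteq> \<C> \<and> F \<in> W J \<and> W J \<subseteq> s" by blast
        qed
      qed
    qed
    with that(2) show ?thesis by blast
  qed
  have "countable \<C>" using \<B>(1) by (simp add: \<C>_def)
  then have "countable (W ` {J. finite J \<and> J \<subseteq> \<C>})"
    by (intro countable_image countable_Collect_finite_subset)
  moreover have "W ` {J. finite J \<and> J \<subseteq> \<C>} \<subseteq> sigma_sets {F. closed F} {miss K |K. compact K}"
    using W_sets by blast
  moreover have "\<exists>V\<in>W ` {J. finite J \<and> J \<subseteq> \<C>}. F \<in> V \<and> V \<subseteq> U"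
    if "openin fell_topology U" "F \<in> U" for U F
    using base[OF that] by blast
  ultimately show ?thesis
    by (rule that)
qed

lemma sets_fell_borel:
  "sets (fell_borel :: 'a set measure) = sigma_sets {F. closed F} {miss K |K. compact K}"
proof -
  obtain \<W> :: "'a set set set" where \<W>: "countable \<W>"
    "\<W> \<subseteq> sigma_sets {F. closed F} {miss K |K. compact K}"
    "\<And>U F. openin fell_topology U \<Longrightarrow> F \<in> U \<Longrightarrow> \<exists>W\<in>\<W>. F \<in> W \<and> W \<subseteq> U"
    using fell_topology_countable_base by blast
  interpret S: sigma_algebra "{F::'a set. closed F}" "sigma_sets {F. closed F} {miss K |K. compact K}"
    by (rule sigma_algebra_sigma_sets) (auto simp: miss_def)
  have openin_subset_closed: "{U. openin fell_topology U} \<subseteq> Pow {F::'a set. closed F}"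
    using openin_subset topspace_fell_topology by blast
  have "openin fell_topology (miss K)" if "compact K" for K :: "'a set"
    unfolding fell_topology_def openin_topology_generated_by_iff miss_def
    using that by (intro generate_topology_on.Basis) blast
  moreover have "U \<in> sigma_sets {F. closed F} {miss K |K. compact K}"
    if "openin fell_topology U" for U :: "'a set set"
  proof -
    have "U = \<Union>{W \<in> \<W>. W \<subseteq> U}" using \<W>(3)[OF that] by blast
    also have "\<dots> \<in> sigma_sets {F. closed F} {miss K |K. compact K}"
      using \<W>(1,2) by (intro S.countable_Union) auto
    finally show ?thesis .
  qed
  ultimately have "sigma_sets {F::'a set. closed F} {U. openin fell_topology U} =
      sigma_sets {F. closed F} {miss K |K. compact K}"
    by (intro sigma_sets_eqI) (auto intro: sigma_sets.Basic)
  then show ?thesis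
    unfolding fell_borel_def topspace_fell_topology
    by (simp add: openin_subset_closed)
qed

end

lemma space_fell_borel: "space (fell_borel :: 'a::topological_space set measure) = {F. closed F}"
  unfolding fell_borel_def topspace_fell_topology
  using openin_subset[of "fell_topology :: 'a set topology"]
  by (subst space_measure_of) (auto simp: topspace_fell_topology)

section \<open>Void functionals and laws\<close>

lemma miss_in_fell_borel:
  assumes "compact K"
  shows "miss K \<in> sets fell_borel"
proof -
  have "openin fell_topology (miss K)"
    unfolding fell_topology_def openin_topology_generated_by_iff miss_def
    using assms by (intro generate_topology_on.Basis) blast
  moreover have "Collect (openin fell_topology) \<subseteq> Pow (topspace fell_topology)"
    using openin_subset by blast
  ultimately show ?thesis
    unfolding fell_borel_def sets_measure_of[OF \<open>Collect _ \<subseteq> _\<close>] by (simp add: sigma_sets.Basic)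
qed

lemma vimage_miss:
  assumes "X \<in> M \<rightarrow>\<^sub>M fell_borel"
  shows "X -` miss K \<inter> space M = {\<omega> \<in> space M. X \<omega> \<inter> K = {}}"
  using measurable_space[OF assms] by (auto simp: miss_def space_fell_borel)

lemma void_functional_conv_distr:
  assumes "random_set M X" "compact K"
  shows "void_functional M X K = measure (distr M fell_borel X) (miss K)"
  using assms
  by (simp add: void_functional_def random_set_def measure_distr miss_in_fell_borel vimage_miss)

lemma void_functional_bounds:
  assumes "random_set M X"
  shows "0 \<le> void_functional M X K" "void_functional M X K \<le> 1"
  using assms by (auto simp: void_functional_def random_set_def prob_space.prob_le_1)

lemma void_functional_union_indep:
  assumes N: "prob_space N" and I: "finite I" "prob_space.indep_vars N (\<lambda>_. fell_borel) Y I"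
    and K: "compact K"
  shows "void_functional N (\<lambda>\<omega>. \<Union>i\<in>I. Y i \<omega>) K = (\<Prod>i\<in>I. void_functional N (Y i) K)"
proof -
  interpret prob_space N by fact
  show ?thesis
  proof (cases "I = {}")
    case True
    then show ?thesis by (simp add: void_functional_def prob_space)
  next
    case False
    have Y: "Y i \<in> N \<rightarrow>\<^sub>M fell_borel" if "i \<in> I" for i
      using I(2) that by (auto simp: indep_vars_def)
    have "void_functional N (\<lambda>\<omega>. \<Union>i\<in>I. Y i \<omega>) K = prob (\<Inter>i\<in>I. Y i -` miss K \<inter> space N)"
      unfolding void_functional_def using False
      by (intro arg_cong[where f = prob]) (auto simp: vimage_miss[OF Y])
    also have "\<dots> = (\<Prod>i\<in>I. prob (Y i -` miss K \<inter> space N))"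
      using False I K by (intro indep_varsD_finite[where M' = "\<lambda>_. fell_borel"]) (auto intro: miss_in_fell_borel)
    also have "\<dots> = (\<Prod>i\<in>I. void_functional N (Y i) K)"
      by (intro prod.cong refl) (simp add: void_functional_def vimage_miss[OF Y])
    finally show ?thesis .
  qed
qed

text \<open>
  The coordinates of the infinite product of the law of \<open>X\<close>. The product lives on sequences of sets,
  which is the type over which divisibility quantifies.
\<close>

lemma ex_iid_copies:
  fixes X :: "'w \<Rightarrow> 'a::topological_space set"
  assumes "random_set M X"
  obtains N :: "'a sample measure" and Y :: "nat \<Rightarrow> 'a sample \<Rightarrow> 'a set"
  where "prob_space N" "\<And>i. random_set N (Y i)"
    "prob_space.indep_vars N (\<lambda>_. fell_borel) Y UNIV"
    "\<And>i. distr N fell_borel (Y i) = distr M fell_borel X"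
proof -
  let ?P = "distr M fell_borel X"
  let ?N = "PiM (UNIV :: nat set) (\<lambda>_. ?P)"
  have P: "prob_space ?P"
    using assms by (simp add: random_set_def prob_space.prob_space_distr)
  interpret N: prob_space ?N
    by (intro prob_space_PiM P)
  have Y: "(\<lambda>\<omega>. \<omega> i) \<in> ?N \<rightarrow>\<^sub>M fell_borel" for i
    using measurable_component_singleton[of i UNIV "\<lambda>_. ?P"] by simp
  have marginal: "distr ?N fell_borel (\<lambda>\<omega>. \<omega> i) = ?P" for i
  proof -
    have "distr ?N fell_borel (\<lambda>\<omega>. \<omega> i) = distr ?N ?P (\<lambda>\<omega>. \<omega> i)"
      by (intro distr_cong) auto
    also have "\<dots> = ?P"
      using distr_PiM_component[of UNIV "\<lambda>_. ?P" i] P by simp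
    finally show ?thesis .
  qed
  have "distr ?N (PiM UNIV (\<lambda>_. fell_borel)) (\<lambda>\<omega>. \<lambda>i\<in>UNIV. \<omega> i) = distr ?N ?N (\<lambda>\<omega>. \<omega>)"
    by (intro distr_cong sets_PiM_cong) auto
  also have "\<dots> = PiM UNIV (\<lambda>i. distr ?N fell_borel (\<lambda>\<omega>. \<omega> i))"
    by (simp add: marginal distr_id2)
  finally have "N.indep_vars (\<lambda>_. fell_borel) (\<lambda>i \<omega>. \<omega> i) UNIV"
    by (subst N.indep_vars_iff_distr_eq_PiM) (use Y in auto)
  moreover have "random_set ?N (\<lambda>\<omega>. \<omega> i)" for i
    using Y N.prob_space_axioms by (simp add: random_set_def)
  ultimately show ?thesis
    using marginal N.prob_space_axioms by (intro that[of ?N "\<lambda>i \<omega>. \<omega> i"]) auto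
qed

lemma ex_random_set_on_sample:
  fixes X :: "'w \<Rightarrow> 'a::topological_space set"
  assumes "random_set M X"
  obtains N :: "'a sample measure" and Y
  where "random_set N Y" "\<And>K. compact K \<Longrightarrow> void_functional N Y K = void_functional M X K"
proof -
  obtain N :: "'a sample measure" and Y :: "nat \<Rightarrow> 'a sample \<Rightarrow> 'a set"
    where "random_set N (Y 0)" "distr N fell_borel (Y 0) = distr M fell_borel X"
    using ex_iid_copies[OF assms] by metis
  with assms show ?thesis
    by (intro that[of N "Y 0"]) (simp_all add: void_functional_conv_distr)
qed

context
  assumes lc: "locally_compact_space (euclidean :: 'a::{t2_space, second_countable_topology} topology)"
begin

lemma measurable_fell_borelI:
  fixes X :: "'w \<Rightarrow> 'a set"
  assumes "\<And>\<omega>. \<omega> \<in> space M \<Longrightarrow> closed (X \<omega>)"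
    and "\<And>K. compact K \<Longrightarrow> {\<omega> \<in> space M. X \<omega> \<inter> K = {}} \<in> sets M"
  shows "X \<in> M \<rightarrow>\<^sub>M fell_borel"
proof (rule measurable_sigma_sets[OF sets_fell_borel[OF lc]])
  fix A assume "A \<in> {miss K |K. compact (K :: 'a set)}"
  then obtain K where K: "compact K" "A = miss K" by blast
  have "X -` A \<inter> space M = {\<omega> \<in> space M. X \<omega> \<inter> K = {}}"
    using assms(1) K by (auto simp: miss_def)
  with assms(2) K show "X -` A \<inter> space M \<in> sets M" by simp
qed (use assms(1) in \<open>auto simp: miss_def\<close>)

lemma measurable_finite_union:
  fixes Y :: "'i \<Rightarrow> 'w \<Rightarrow> 'a set"
  assumes "finite I" and Y: "\<And>i. i \<in> I \<Longrightarrow> Y i \<in> M \<rightarrow>\<^sub>M fell_borel"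
  shows "(\<lambda>\<omega>. \<Union>i\<in>I. Y i \<omega>) \<in> M \<rightarrow>\<^sub>M fell_borel"
proof (rule measurable_fell_borelI)
  show "closed (\<Union>i\<in>I. Y i \<omega>)" if "\<omega> \<in> space M" for \<omega>
    using assms measurable_space[OF Y that] by (auto simp: space_fell_borel)
next
  fix K :: "'a set" assume K: "compact K"
  have "{\<omega> \<in> space M. \<forall>i\<in>I. Y i \<omega> \<inter> K = {}} \<in> sets M"
    using measurable_sets[OF Y miss_in_fell_borel[OF K]] assms(1)
    by (intro sets.sets_Collect_finite_All) (auto simp: vimage_miss[OF Y])
  moreover have "(\<Union>i\<in>I. Y i \<omega>) \<inter> K = {} \<longleftrightarrow> (\<forall>i\<in>I. Y i \<omega> \<inter> K = {})" for \<omega>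
    by blast
  ultimately show "{\<omega> \<in> space M. (\<Union>i\<in>I. Y i \<omega>) \<inter> K = {}} \<in> sets M"
    by simp
qed

text \<open>
  The events "misses \<open>K\<close>" form a generating \<open>\<pi>\<close>-system, because missing \<open>K\<close> and \<open>L\<close> is missing
  \<open>K \<union> L\<close>.
\<close>

lemma distr_eq_iff_void_functional:
  fixes X :: "'w \<Rightarrow> 'a set" and Y :: "'v \<Rightarrow> 'a set"
  assumes X: "random_set M X" and Y: "random_set N Y"
  shows "distr M fell_borel X = distr N fell_borel Y \<longleftrightarrow>
    (\<forall>K. compact K \<longrightarrow> void_functional M X K = void_functional N Y K)"
proof
  assume eq: "\<forall>K. compact K \<longrightarrow> void_functional M X K = void_functional N Y K"
  interpret P: prob_space "distr M fell_borel X"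
    using X by (simp add: random_set_def prob_space.prob_space_distr)
  interpret Q: prob_space "distr N fell_borel Y"
    using Y by (simp add: random_set_def prob_space.prob_space_distr)
  show "distr M fell_borel X = distr N fell_borel Y"
  proof (rule measure_eqI_generator_eq[where E = "{miss K |K. compact K}" and \<Omega> = "{F. closed F}"
        and A = "\<lambda>_. miss {}"])
    show "Int_stable {miss K |K. compact (K :: 'a set)}"
      unfolding Int_stable_def using miss_Un compact_Un by blast
    show "emeasure (distr M fell_borel X) A = emeasure (distr N fell_borel Y) A"
      if "A \<in> {miss K |K. compact (K :: 'a set)}" for A
      using that eq X Y
      by (auto simp: P.emeasure_eq_measure Q.emeasure_eq_measure void_functional_conv_distr)
    show "range (\<lambda>_. miss {}) \<subseteq> {miss K |K. compact (K :: 'a set)}"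
      using compact_empty by blast
  qed (auto simp: sets_fell_borel[OF lc] miss_def)
qed (use X Y in \<open>simp add: void_functional_conv_distr\<close>)

section \<open>Divisibility in terms of void functionals\<close>

text \<open>
  One direction is the product formula for independent unions. For the other, the union of \<open>m\<close>
  independent copies of a root has the void functional of \<open>X\<close>, hence its law.
\<close>

lemma divisible_iff_void_functional_root:
  fixes X :: "'w \<Rightarrow> 'a set"
  assumes X: "random_set M X" and m: "1 \<le> m"
  shows "divisible m M X \<longleftrightarrow> (\<exists>(N :: 'a sample measure) Y. random_set N Y \<and>
    (\<forall>K. compact K \<longrightarrow> void_functional M X K = void_functional N Y K ^ m))"
proof
  assume "divisible m M X"
  then obtain N :: "'a sample measure" and Y where N: "prob_space N"
    and Y: "\<And>i. i \<in> {1..m} \<Longrightarrow> random_set N (Y i)"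
    and ind: "prob_space.indep_vars N (\<lambda>_. fell_borel) Y {1..m}"
    and id: "\<And>i j. i \<in> {1..m} \<Longrightarrow> j \<in> {1..m} \<Longrightarrow> distr N fell_borel (Y i) = distr N fell_borel (Y j)"
    and law: "distr M fell_borel X = distr N fell_borel (\<lambda>\<omega>. \<Union>i\<in>{1..m}. Y i \<omega>)"
    unfolding divisible_def by blast
  have U: "random_set N (\<lambda>\<omega>. \<Union>i\<in>{1..m}. Y i \<omega>)"
    unfolding random_set_def using N Y by (auto intro!: measurable_finite_union simp: random_set_def)
  have "void_functional M X K = void_functional N (Y 1) K ^ m" if K: "compact K" for K
  proof -
    have "void_functional M X K = void_functional N (\<lambda>\<omega>. \<Union>i\<in>{1..m}. Y i \<omega>) K"
      using distr_eq_iff_void_functional[OF X U] law K by blast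
    also have "\<dots> = (\<Prod>i\<in>{1..m}. void_functional N (Y i) K)"
      by (intro void_functional_union_indep N ind K) simp
    also have "\<dots> = (\<Prod>i\<in>{1..m}. void_functional N (Y 1) K)"
    proof (rule prod.cong[OF refl])
      fix i assume i: "i \<in> {1..m}"
      have 1: "1 \<in> {1..m}" using m by simp
      show "void_functional N (Y i) K = void_functional N (Y 1) K"
        unfolding void_functional_conv_distr[OF Y[OF i] K] void_functional_conv_distr[OF Y[OF 1] K]
          id[OF i 1] ..
    qed
    finally show ?thesis by simp
  qed
  moreover have "random_set N (Y 1)" using Y m by simp
  ultimately show "\<exists>(N :: 'a sample measure) Y. random_set N Y \<and>
      (\<forall>K. compact K \<longrightarrow> void_functional M X K = void_functional N Y K ^ m)" by blast
next
  assume "\<exists>(N :: 'a sample measure) Y. random_set N Y \<and>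
    (\<forall>K. compact K \<longrightarrow> void_functional M X K = void_functional N Y K ^ m)"
  then obtain N0 :: "'a sample measure" and Y0 where Y0: "random_set N0 Y0"
    and root: "\<And>K. compact K \<Longrightarrow> void_functional M X K = void_functional N0 Y0 K ^ m" by blast
  obtain N :: "'a sample measure" and Y :: "nat \<Rightarrow> 'a sample \<Rightarrow> 'a set" where N: "prob_space N"
    and Y: "\<And>i. random_set N (Y i)" and ind: "prob_space.indep_vars N (\<lambda>_. fell_borel) Y UNIV"
    and id: "\<And>i. distr N fell_borel (Y i) = distr N0 fell_borel Y0"
    using ex_iid_copies[OF Y0] by blast
  have ind_m: "prob_space.indep_vars N (\<lambda>_. fell_borel) Y {1..m}"
    by (rule prob_space.indep_vars_subset[OF N ind]) simp
  have U: "random_set N (\<lambda>\<omega>. \<Union>i\<in>{1..m}. Y i \<omega>)"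
    unfolding random_set_def using N Y by (auto intro!: measurable_finite_union simp: random_set_def)
  have "void_functional N (\<lambda>\<omega>. \<Union>i\<in>{1..m}. Y i \<omega>) K = void_functional M X K" if K: "compact K" for K
  proof -
    have "void_functional N (\<lambda>\<omega>. \<Union>i\<in>{1..m}. Y i \<omega>) K = (\<Prod>i\<in>{1..m}. void_functional N (Y i) K)"
      by (intro void_functional_union_indep N ind_m K) simp
    then show ?thesis
      by (simp add: void_functional_conv_distr[OF Y K] id root[OF K] void_functional_conv_distr[OF Y0 K])
  qed
  then have "distr M fell_borel X = distr N fell_borel (\<lambda>\<omega>. \<Union>i\<in>{1..m}. Y i \<omega>)"
    using distr_eq_iff_void_functional[OF X U] by simp
  with N Y ind_m id show "divisible m M X"
    unfolding divisible_def by (intro exI[of _ N] exI[of _ Y]) simp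
qed

lemma ex_divisible_void_functional_power:
  fixes X :: "'w \<Rightarrow> 'a set"
  assumes "random_set M X" and m: "1 \<le> m"
  obtains N :: "'a sample measure" and Z
  where "(N, Z) \<in> D m" "\<And>K. compact K \<Longrightarrow> void_functional N Z K = void_functional M X K ^ m"
proof -
  obtain N :: "'a sample measure" and Y :: "nat \<Rightarrow> 'a sample \<Rightarrow> 'a set" where N: "prob_space N"
    and Y: "\<And>i. random_set N (Y i)" and ind: "prob_space.indep_vars N (\<lambda>_. fell_borel) Y UNIV"
    and id: "\<And>i. distr N fell_borel (Y i) = distr M fell_borel X"
    using ex_iid_copies[OF assms(1)] by blast
  define Z where "Z = (\<lambda>\<omega>. \<Union>i\<in>{1..m}. Y i \<omega>)"
  have ind_m: "prob_space.indep_vars N (\<lambda>_. fell_borel) Y {1..m}"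
    by (rule prob_space.indep_vars_subset[OF N ind]) simp
  have Z: "random_set N Z"
    unfolding random_set_def Z_def using N Y
    by (auto intro!: measurable_finite_union simp: random_set_def)
  have "divisible m N Z"
    unfolding divisible_def using N Y ind_m id by (intro exI[of _ N] exI[of _ Y]) (simp add: Z_def)
  moreover have "void_functional N Z K = void_functional M X K ^ m" if K: "compact K" for K
    unfolding Z_def
    by (subst void_functional_union_indep[OF N _ ind_m K])
      (simp_all add: void_functional_conv_distr[OF Y K] id void_functional_conv_distr[OF assms(1) K])
  ultimately show ?thesis
    using Z by (intro that[of N Z]) (auto simp: D_def)
qed

section \<open>Compound Poisson random sets\<close>

text \<open>The probability generating function of the Poisson distribution.\<close>

lemma nn_integral_power_poisson_pmf:
  assumes "0 < r" "0 \<le> v"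
  shows "(\<integral>\<^sup>+n. ennreal (v ^ n) \<partial>measure_pmf (poisson_pmf r)) = ennreal (exp (- r * (1 - v)))"
proof -
  have "(\<integral>\<^sup>+n. ennreal (v ^ n) \<partial>measure_pmf (poisson_pmf r)) =
      (\<Sum>n. ennreal ((r * v) ^ n /\<^sub>R fact n * exp (- r)))"
    using assms
    by (simp add: nn_integral_measure_pmf nn_integral_count_space_nat ennreal_mult[symmetric]
        field_simps power_mult_distrib)
  also have "\<dots> = ennreal (exp (r * v) * exp (- r))"
    using assms by (intro suminf_ennreal_eq sums_mult2 exp_converges) auto
  also have "exp (r * v) * exp (- r) = exp (- r * (1 - v))"
    by (simp add: mult_exp_exp algebra_simps)
  finally show ?thesis .
qed

text \<open>
  The set is a union of a Poisson number of independent copies of \<open>X\<close>. Given that the number is \<open>n\<close>,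
  it misses \<open>K\<close> with probability \<open>V\<^sub>X(K) ^ n\<close>; averaging over \<open>n\<close> gives the generating function.
\<close>

lemma ex_compound_poisson:
  fixes X :: "'w \<Rightarrow> 'a set"
  assumes X: "random_set M X" and r: "0 < r"
  obtains N :: "'a sample measure" and Z
  where "random_set N Z"
    "\<And>K. compact K \<Longrightarrow> void_functional N Z K = exp (- r * (1 - void_functional M X K))"
proof -
  obtain N :: "'a sample measure" and Y :: "nat \<Rightarrow> 'a sample \<Rightarrow> 'a set" where N: "prob_space N"
    and Y: "\<And>i. random_set N (Y i)" and ind: "prob_space.indep_vars N (\<lambda>_. fell_borel) Y UNIV"
    and id: "\<And>i. distr N fell_borel (Y i) = distr M fell_borel X"
    using ex_iid_copies[OF X] by blast
  interpret N: prob_space N by fact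
  interpret pair_prob_space "measure_pmf (poisson_pmf r)" N ..
  let ?R = "measure_pmf (poisson_pmf r) \<Otimes>\<^sub>M N"
  define Z where "Z p = (\<Union>i<fst p. Y i (snd p))" for p
  have "Z \<in> ?R \<rightarrow>\<^sub>M fell_borel"
    unfolding Z_def
  proof (rule measurable_compose_countable[where g = fst and f = "\<lambda>n p. \<Union>i<n. Y i (snd p)"])
    show "(\<lambda>p. \<Union>i<n. Y i (snd p)) \<in> ?R \<rightarrow>\<^sub>M fell_borel" for n
      using Y by (intro measurable_finite_union measurable_compose[OF measurable_snd])
        (auto simp: random_set_def)
    show "fst \<in> ?R \<rightarrow>\<^sub>M count_space UNIV"
      using measurable_fst[of "measure_pmf (poisson_pmf r)" N] by simp
  qed
  then have Z: "random_set ?R Z"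
    using prob_space_axioms by (simp add: random_set_def)
  have "void_functional ?R Z K = exp (- r * (1 - void_functional M X K))" if K: "compact K" for K
  proof -
    let ?v = "void_functional M X K"
    let ?A = "{p \<in> space ?R. Z p \<inter> K = {}}"
    have A: "?A \<in> sets ?R"
      using measurable_sets[OF _ miss_in_fell_borel[OF K], of Z ?R] Z
      by (simp add: random_set_def vimage_miss)
    have "N.prob (Pair n -` ?A) = ?v ^ n" for n
    proof -
      have "N.prob (Pair n -` ?A) = void_functional N (\<lambda>\<omega>. \<Union>i\<in>{..<n}. Y i \<omega>) K"
        unfolding void_functional_def
        by (intro arg_cong[where f = N.prob]) (auto simp: space_pair_measure Z_def)
      also have "\<dots> = (\<Prod>i<n. void_functional N (Y i) K)"
        by (intro void_functional_union_indep N K N.indep_vars_subset[OF ind]) auto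
      also have "\<dots> = ?v ^ n"
        by (simp add: void_functional_conv_distr[OF Y K] id void_functional_conv_distr[OF X K])
      finally show ?thesis .
    qed
    then have "emeasure ?R ?A = (\<integral>\<^sup>+n. ennreal (?v ^ n) \<partial>measure_pmf (poisson_pmf r))"
      by (simp add: N.emeasure_pair_measure_alt[OF A] N.emeasure_eq_measure)
    also have "\<dots> = ennreal (exp (- r * (1 - ?v)))"
      by (intro nn_integral_power_poisson_pmf r void_functional_bounds X)
    finally show ?thesis
      unfolding void_functional_def by (simp add: measure_def)
  qed
  with ex_random_set_on_sample[OF Z] that show ?thesis by metis
qed

text \<open>The \<open>n\<close>-th root of the void functional is that of the compound Poisson set with mean \<open>r / n\<close>.\<close>

lemma ex_infinitely_divisible_compound_poisson:
  fixes X :: "'w \<Rightarrow> 'a set"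
  assumes X: "random_set M X" and r: "0 < r"
  obtains N :: "'a sample measure" and Z
  where "(N, Z) \<in> D_inf"
    "\<And>K. compact K \<Longrightarrow> void_functional N Z K = exp (- r * (1 - void_functional M X K))"
proof -
  obtain N :: "'a sample measure" and Z where Z: "random_set N Z"
    "\<And>K. compact K \<Longrightarrow> void_functional N Z K = exp (- r * (1 - void_functional M X K))"
    using ex_compound_poisson[OF X r] by blast
  have "divisible n N Z" if n: "1 \<le> n" for n
  proof -
    have "0 < r / n" using r n by simp
    then obtain L :: "'a sample measure" and Y where Y: "random_set L Y"
      "\<And>K. compact K \<Longrightarrow> void_functional L Y K = exp (- (r / n) * (1 - void_functional M X K))"
      using ex_compound_poisson[OF X] by blast
    have "void_functional N Z K = void_functional L Y K ^ n" if "compact K" for K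
      using that n by (simp add: Z(2) Y(2) exp_of_nat_mult[symmetric])
    with Y(1) show ?thesis
      by (subst divisible_iff_void_functional_root[OF Z(1) n]) blast
  qed
  with Z show ?thesis
    by (intro that[of N Z]) (auto simp: D_inf_def infinitely_divisible_def)
qed

end

section \<open>The upper bound\<close>

text \<open>
  With \<open>x = 1 - v\<close> and \<open>t = m x\<close>, the inequality \<open>1 + x \<le> exp x\<close> at \<open>- x\<close> gives \<open>v ^ m \<le> exp (- t)\<close>, and at
  \<open>x\<close> it gives \<open>exp t * v ^ m \<ge> (1 - x\<^sup>2) ^ m \<ge> 1 - m x\<^sup>2\<close>. So the error is at most \<open>m x\<^sup>2 exp (- t)\<close>,
  which is \<open>t\<^sup>2 exp (- t) / m\<close>, and \<open>t\<^sup>2 / 2 \<le> exp t\<close>.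
\<close>

lemma exp_minus_power_bounds:
  fixes v :: real
  assumes v: "0 \<le> v" "v \<le> 1" and m: "1 \<le> m"
  shows "\<bar>v ^ m - exp (- real m * (1 - v))\<bar> \<le> 2 / real m"
proof -
  define x where "x = 1 - v"
  have x: "0 \<le> x" "x \<le> 1" using v by (auto simp: x_def)
  define t where "t = real m * x"
  have t: "0 \<le> t" using x by (simp add: t_def)
  have exp_pow: "exp (- t) = exp (- x) ^ m"
    by (simp add: t_def exp_of_nat_mult[symmetric])
  have upper: "v ^ m \<le> exp (- t)"
    unfolding exp_pow using exp_ge_add_one_self[of "- x"] v by (intro power_mono) (auto simp: x_def)
  have "x * x \<le> 1" using x by (simp add: mult_le_one)
  then have "1 - real m * x\<^sup>2 \<le> (1 - x\<^sup>2) ^ m"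
    using Bernoulli_inequality[of "- x\<^sup>2" m] by (simp add: power2_eq_square)
  also have "(1 - x\<^sup>2) ^ m = (1 + x) ^ m * v ^ m"
    by (simp add: x_def power_mult_distrib[symmetric] power2_eq_square algebra_simps)
  also have "\<dots> \<le> exp t * v ^ m"
    using exp_ge_add_one_self[of x] x v
    by (intro mult_right_mono) (auto simp: t_def exp_of_nat_mult intro!: power_mono)
  finally have "exp (- t) * (1 - real m * x\<^sup>2) \<le> exp (- t) * (exp t * v ^ m)"
    by (intro mult_left_mono) auto
  also have "exp (- t) * (exp t * v ^ m) = v ^ m"
    by (simp add: exp_minus mult.assoc[symmetric])
  finally have lower: "exp (- t) - v ^ m \<le> real m * x\<^sup>2 * exp (- t)"
    by (simp add: algebra_simps)
  have "t\<^sup>2 / 2 \<le> exp t"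
    using exp_lower_Taylor_quadratic[OF t] t by linarith
  then have "t\<^sup>2 * exp (- t) \<le> 2"
    by (simp add: exp_minus field_simps)
  moreover have "real m * x\<^sup>2 * exp (- t) * real m = t\<^sup>2 * exp (- t)"
    by (simp add: t_def power2_eq_square)
  ultimately have "real m * x\<^sup>2 * exp (- t) * real m \<le> 2"
    by linarith
  then have "real m * x\<^sup>2 * exp (- t) \<le> 2 / real m"
    using m by (intro mult_imp_le_div_pos) simp_all
  with upper lower show ?thesis by (simp add: t_def x_def)
qed

lemma d_V_le:
  assumes "\<And>K. compact K \<Longrightarrow> \<bar>void_functional M X K - void_functional N Y K\<bar> \<le> c"
  shows "d_V (M, X) (N, Y) \<le> c"
  unfolding d_V_def split using assms compact_empty by (intro cSUP_least) auto

lemma le_d_V: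
  assumes "random_set M X" "random_set N Y" "compact K"
  shows "\<bar>void_functional M X K - void_functional N Y K\<bar> \<le> d_V (M, X) (N, Y)"
proof -
  have "\<bar>void_functional M X L - void_functional N Y L\<bar> \<le> 1" for L
    using void_functional_bounds[OF assms(1), of L] void_functional_bounds[OF assms(2), of L] by linarith
  then show ?thesis
    unfolding d_V_def split using assms(3) by (intro cSUP_upper bdd_aboveI[of _ 1]) auto
qed

lemma bdd_below_d_V:
  assumes "random_set M X"
  shows "bdd_below (d_V (M, X) ` D_inf)"
proof (rule bdd_belowI)
  fix r assume "r \<in> d_V (M, X) ` D_inf"
  then obtain N Y where "random_set N Y" "r = d_V (M, X) (N, Y)" by (auto simp: D_inf_def)
  with le_d_V[OF assms, of N Y "{}"] show "0 \<le> r" by simp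
qed

context
  assumes lc: "locally_compact_space (euclidean :: 'a::{t2_space, second_countable_topology} topology)"
begin

lemma INF_d_V_le:
  assumes m: "1 \<le> m" and X: "(M, X) \<in> (D m :: 'a rset set)"
  shows "(INF Y \<in> D_inf. d_V (M, X) Y) \<le> 2 / real m"
proof -
  have M: "random_set M X" "divisible m M X" using X by (auto simp: D_def)
  obtain L :: "'a sample measure" and R where R: "random_set L R"
    "\<And>K. compact K \<Longrightarrow> void_functional M X K = void_functional L R K ^ m"
    using iffD1[OF divisible_iff_void_functional_root[OF lc M(1) m] M(2)] by blast
  have "0 < real m" using m by simp
  then obtain N :: "'a sample measure" and Z where Z: "(N, Z) \<in> D_inf"
    "\<And>K. compact K \<Longrightarrow> void_functional N Z K = exp (- real m * (1 - void_functional L R K))"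
    using ex_infinitely_divisible_compound_poisson[OF lc R(1)] by blast
  have "d_V (M, X) (N, Z) \<le> 2 / real m"
  proof (rule d_V_le)
    fix K :: "'a set" assume "compact K"
    then show "\<bar>void_functional M X K - void_functional N Z K\<bar> \<le> 2 / real m"
      using exp_minus_power_bounds[OF void_functional_bounds[OF R(1)] m] by (simp add: R(2) Z(2))
  qed
  with bdd_below_d_V[OF M(1)] Z(1) show ?thesis
    by (intro cINF_lower2)
qed

end

section \<open>The lower bound\<close>

text \<open>Inclusion and exclusion for the events of missing \<open>K\<close> and of missing \<open>L\<close>.\<close>

lemma void_functional_Un_ge:
  assumes X: "random_set M X" and K: "compact K" "compact L"
  shows "void_functional M X K + void_functional M X L - 1 \<le> void_functional M X (K \<union> L)"
proof -
  interpret prob_space M using X by (simp add: random_set_def)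
  have miss: "{\<omega> \<in> space M. X \<omega> \<inter> C = {}} \<in> sets M" if "compact C" for C
    using measurable_sets[OF _ miss_in_fell_borel[OF that], of X M] X
    by (simp add: random_set_def vimage_miss)
  let ?A = "{\<omega> \<in> space M. X \<omega> \<inter> K = {}}" and ?B = "{\<omega> \<in> space M. X \<omega> \<inter> L = {}}"
  have "prob ?A + prob ?B = prob (?A \<union> ?B) + prob (?A \<inter> ?B)"
    using miss[OF K(1)] miss[OF K(2)] by (simp add: measure_Un3 fmeasurable_eq_sets)
  moreover have "?A \<inter> ?B = {\<omega> \<in> space M. X \<omega> \<inter> (K \<union> L) = {}}" by blast
  moreover have "prob (?A \<union> ?B) \<le> 1" by simp
  ultimately show ?thesis by (simp add: void_functional_def)
qed

lemma power_diff_le_mult: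
  fixes s c :: real
  assumes "0 \<le> c" "c \<le> s" "s \<le> 1"
  shows "s ^ n - c ^ n \<le> real n * (s - c)"
  using norm_power_diff[of s c n] assms power_mono[of c s n] by simp

text \<open>
  The inclusion-exclusion bound for all roots sharpens to a product inequality. Indeed
  \<open>\<alpha> \<beta> - \<gamma> \<le> (1 - \<alpha>) (1 - \<beta>)\<close>, and \<open>1 - \<alpha> \<le> - ln \<alpha> = - ln a / n\<close>, likewise for \<open>\<beta>\<close>. So \<open>a b - c\<close>, the
  difference of two \<open>n\<close>-th powers, is at most \<open>n\<close> times a quantity of order \<open>1 / n\<^sup>2\<close> and vanishes in
  the limit unless it is negative.
\<close>

lemma roots_mult_le:
  fixes a b c :: real
  assumes "\<And>n. 1 \<le> n \<Longrightarrow> \<exists>\<alpha> \<beta> \<gamma>. 0 \<le> \<alpha> \<and> \<alpha> \<le> 1 \<and> 0 \<le> \<beta> \<and> \<beta> \<le> 1 \<and> 0 \<le> \<gamma> \<and> \<alpha> + \<beta> - 1 \<le> \<gamma> \<and>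
    \<alpha> ^ n = a \<and> \<beta> ^ n = b \<and> \<gamma> ^ n = c"
  shows "a * b \<le> c"
proof (cases "0 < a \<and> 0 < b")
  case False
  obtain \<alpha> \<beta> \<gamma> where "0 \<le> \<alpha>" "0 \<le> \<beta>" "0 \<le> \<gamma>" "\<alpha> = a" "\<beta> = b" "\<gamma> = c"
    using assms[of 1] by auto
  moreover from this False have "a = 0 \<or> b = 0" by auto
  ultimately show ?thesis by auto
next
  case True
  have bound: "a * b - c \<le> ln a * ln b / real n" if n: "1 \<le> n" for n :: nat
  proof -
    obtain \<alpha> \<beta> \<gamma> where r: "0 \<le> \<alpha>" "\<alpha> \<le> 1" "0 \<le> \<beta>" "\<beta> \<le> 1" "0 \<le> \<gamma>" "\<alpha> + \<beta> - 1 \<le> \<gamma>"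
      and pow: "\<alpha> ^ n = a" "\<beta> ^ n = b" "\<gamma> ^ n = c"
      using assms[OF n] by blast
    have pos: "0 < \<alpha>" "0 < \<beta>"
      using True pow r n by (auto simp: less_le)
    have ln: "ln a = real n * ln \<alpha>" "ln b = real n * ln \<beta>"
      using pos by (simp_all add: pow[symmetric] ln_realpow)
    have "a * b - c \<le> real n * ((1 - \<alpha>) * (1 - \<beta>))"
    proof (cases "\<gamma> \<le> \<alpha> * \<beta>")
      case True
      then have "a * b - c \<le> real n * (\<alpha> * \<beta> - \<gamma>)"
        using power_diff_le_mult[of \<gamma> "\<alpha> * \<beta>" n] r
        by (simp add: pow[symmetric] power_mult_distrib mult_le_one)
      also have "\<dots> \<le> real n * ((1 - \<alpha>) * (1 - \<beta>))"
        using r by (intro mult_left_mono) (auto simp: algebra_simps)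
      finally show ?thesis .
    next
      case False
      then have "a * b \<le> c"
        using r by (auto simp: pow[symmetric] power_mult_distrib[symmetric] intro!: power_mono)
      moreover have "0 \<le> real n * ((1 - \<alpha>) * (1 - \<beta>))" using r by simp
      ultimately show ?thesis by linarith
    qed
    also have "\<dots> \<le> real n * ((- ln \<alpha>) * (- ln \<beta>))"
      using pos r ln_le_minus_one[of \<alpha>] ln_le_minus_one[of \<beta>]
      by (intro mult_left_mono mult_mono) auto
    also have "\<dots> = ln a * ln b / real n"
      using n by (simp add: ln)
    finally show ?thesis .
  qed
  have "(\<lambda>n. ln a * ln b / real n) \<longlonglongrightarrow> 0"
    by (rule lim_const_over_n)
  then have "a * b - c \<le> 0"
    by (rule Lim_bounded2[where N = 1]) (use bound in blast)
  then show ?thesis by simp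
qed

text \<open>
  Since \<open>(1 - p)\<^sup>2 = b + p\<^sup>2\<close> with \<open>b = 1 - 2 p\<close>, the difference is at least \<open>m p\<^sup>2 b ^ (m - 1)\<close>. The
  choice of \<open>p\<close> as a multiple of \<open>1 / m\<close> makes \<open>m p\<^sup>2\<close> of order \<open>1 / m\<close> and, with the factor \<open>1 / 4\<close>,
  Bernoulli's inequality keeps \<open>b ^ (m - 1)\<close> above one half.
\<close>

lemma two_point_correlation_gap:
  assumes "1 \<le> m"
  defines "p \<equiv> 1 / (4 * real m)"
  shows "1 / (32 * real m) \<le> (1 - p) ^ m * (1 - p) ^ m - (1 - 2 * p) ^ m"
proof -
  define a where "a = (1 - p) * (1 - p)"
  define b where "b = 1 - 2 * p"
  have p: "0 < p" "p \<le> 1 / 4" using assms by (auto simp: field_simps)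
  have ab: "a = b + p * p" by (simp add: a_def b_def algebra_simps)
  have b: "0 < b" using p by (simp add: b_def)
  have "1 / 2 \<le> 1 - 2 * p * real (m - 1)"
    using assms by (simp add: field_simps of_nat_diff)
  also have "\<dots> \<le> b ^ (m - 1)"
    using Bernoulli_inequality[of "- 2 * p" "m - 1"] p by (simp add: b_def algebra_simps)
  finally have half: "1 / 2 \<le> b ^ (m - 1)" .
  have "- 1 \<le> p * p / b" by (rule order_trans[of _ 0]) (use b in simp_all)
  then have "b ^ m * (1 + real m * (p * p / b)) \<le> b ^ m * (1 + p * p / b) ^ m"
    using b by (intro mult_left_mono Bernoulli_inequality) simp_all
  also have "\<dots> = (b * (1 + p * p / b)) ^ m"
    by (simp only: power_mult_distrib)
  also have "b * (1 + p * p / b) = a"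
    using b by (simp add: ab distrib_left)
  finally have "b ^ m + real m * (p * p) * (b ^ m / b) \<le> a ^ m"
    by (simp add: algebra_simps)
  also have "b ^ m / b = b ^ (m - 1)"
    using b assms by (simp add: power_diff)
  finally have "real m * (p * p) * b ^ (m - 1) \<le> a ^ m - b ^ m" by simp
  moreover have "real m * (p * p) * (1 / 2) \<le> real m * (p * p) * b ^ (m - 1)"
    using half by (intro mult_left_mono) auto
  moreover have "real m * (p * p) * (1 / 2) = 1 / (32 * real m)"
    using assms by (simp add: field_simps)
  ultimately show ?thesis by (simp add: a_def b_def power_mult_distrib)
qed

context
  assumes lc: "locally_compact_space (euclidean :: 'a::{t2_space, second_countable_topology} topology)"
begin

lemma infinitely_divisible_void_functional_Un:
  assumes N: "random_set N (Y :: 'w \<Rightarrow> 'a set)" "infinitely_divisible N Y" and K: "compact K" "compact L"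
  shows "void_functional N Y K * void_functional N Y L \<le> void_functional N Y (K \<union> L)"
proof (rule roots_mult_le)
  fix n :: nat assume n: "1 \<le> n"
  with N(2) have div: "divisible n N Y" by (simp add: infinitely_divisible_def)
  obtain P :: "'a sample measure" and R where R: "random_set P R"
    "\<And>C. compact C \<Longrightarrow> void_functional N Y C = void_functional P R C ^ n"
    using iffD1[OF divisible_iff_void_functional_root[OF lc N(1) n] div] by blast
  show "\<exists>\<alpha> \<beta> \<gamma>. 0 \<le> \<alpha> \<and> \<alpha> \<le> 1 \<and> 0 \<le> \<beta> \<and> \<beta> \<le> 1 \<and> 0 \<le> \<gamma> \<and> \<alpha> + \<beta> - 1 \<le> \<gamma> \<and>
    \<alpha> ^ n = void_functional N Y K \<and> \<beta> ^ n = void_functional N Y L \<and> \<gamma> ^ n = void_functional N Y (K \<union> L)"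
    by (rule exI[of _ "void_functional P R K"], rule exI[of _ "void_functional P R L"],
        rule exI[of _ "void_functional P R (K \<union> L)"])
      (simp add: R K compact_Un void_functional_bounds[OF R(1)] void_functional_Un_ge[OF R(1) K])
qed

text \<open>
  The root is realised on a uniform choice from \<open>4 m\<close> outcomes, of which one yields \<open>{x}\<close>, one yields
  \<open>{y}\<close> and all others the empty set.
\<close>

lemma ex_divisible_two_points:
  fixes x y :: 'a
  assumes "x \<noteq> y" and m: "1 \<le> m"
  defines "p \<equiv> 1 / (4 * real m)"
  obtains M and X :: "'a sample \<Rightarrow> 'a set" where "(M, X) \<in> D m"
    "void_functional M X {x} = (1 - p) ^ m" "void_functional M X {y} = (1 - p) ^ m"
    "void_functional M X {x, y} = (1 - 2 * p) ^ m"
proof -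
  let ?P = "measure_pmf (pmf_of_set {..<4 * m})"
  define A :: "nat \<Rightarrow> 'a set" where "A n = (if n = 0 then {x} else if n = 1 then {y} else {})" for n
  have "A \<in> ?P \<rightarrow>\<^sub>M fell_borel"
    by (rule measurable_fell_borelI[OF lc]) (auto simp: A_def)
  then have A: "random_set ?P A"
    by (simp add: random_set_def measure_pmf.prob_space_axioms)
  have V: "void_functional ?P A K = real (card ({..<4 * m} - I)) / real (4 * m)"
    if "\<And>n. A n \<inter> K = {} \<longleftrightarrow> n \<notin> I" for K I
  proof -
    have "{..<4 * m} \<inter> {n. n \<notin> I} = {..<4 * m} - I" by blast
    then show ?thesis
      using m by (simp add: void_functional_def that measure_pmf_of_set lessThan_empty_iff)
  qed
  have "void_functional ?P A {x} = 1 - p"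
    by (subst V[of _ "{0}"]) (use assms in \<open>auto simp: A_def card_Diff_subset of_nat_diff field_simps\<close>)
  moreover have "void_functional ?P A {y} = 1 - p"
    by (subst V[of _ "{1}"]) (use assms in \<open>auto simp: A_def card_Diff_subset of_nat_diff field_simps\<close>)
  moreover have "void_functional ?P A {x, y} = 1 - 2 * p"
    by (subst V[of _ "{0, 1}"]) (use assms in \<open>auto simp: A_def card_Diff_subset of_nat_diff field_simps\<close>)
  moreover obtain M and X :: "'a sample \<Rightarrow> 'a set" where "(M, X) \<in> D m"
    "\<And>K. compact K \<Longrightarrow> void_functional M X K = void_functional ?P A K ^ m"
    using ex_divisible_void_functional_power[OF lc A m] by blast
  ultimately show ?thesis
    by (intro that[of M X]) simp_all
qed

text \<open>
  The constant is \<open>1 / 96 = (1 / 32) / 3\<close>: the defect of correlation is at least \<open>1 / (32 m)\<close>, and two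
  void functionals at distance \<open>d\<close> have defects that differ by at most \<open>3 d\<close>.
\<close>

lemma d_V_two_points_ge:
  fixes x y :: 'a
  assumes "x \<noteq> y" and m: "1 \<le> m"
  obtains M and X :: "'a sample \<Rightarrow> 'a set" where "(M, X) \<in> D m"
    "\<And>Y. Y \<in> D_inf \<Longrightarrow> (1 / 96) / real m \<le> d_V (M, X) Y"
proof -
  let ?p = "1 / (4 * real m)"
  obtain M and X :: "'a sample \<Rightarrow> 'a set" where X: "(M, X) \<in> D m"
    and V: "void_functional M X {x} = (1 - ?p) ^ m" "void_functional M X {y} = (1 - ?p) ^ m"
    "void_functional M X {x, y} = (1 - 2 * ?p) ^ m"
    using ex_divisible_two_points[OF assms] by blast
  have M: "random_set M X" using X by (simp add: D_def)
  have "(1 / 96) / real m \<le> d_V (M, X) (N, Y)" if "(N, Y) \<in> D_inf" for N and Y :: "'a sample \<Rightarrow> 'a set"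
  proof -
    have N: "random_set N Y" "infinitely_divisible N Y" using that by (auto simp: D_inf_def)
    let ?d = "d_V (M, X) (N, Y)" and ?V = "void_functional M X" and ?W = "void_functional N Y"
    have close: "\<bar>?V K - ?W K\<bar> \<le> ?d" if "compact K" for K
      by (rule le_d_V[OF M N(1) that])
    have "?W {x} * ?W {y} \<le> ?W ({x} \<union> {y})"
      by (intro infinitely_divisible_void_functional_Un N) auto
    then have corr: "?W {x} * ?W {y} \<le> ?W {x, y}" by (simp add: insert_is_Un[of x "{y}"])
    have "?V {x} * ?V {y} - ?W {x} * ?W {y} = ?V {x} * (?V {y} - ?W {y}) + (?V {x} - ?W {x}) * ?W {y}"
      by (simp add: algebra_simps)
    also have "\<dots> \<le> \<bar>?V {x} * (?V {y} - ?W {y})\<bar> + \<bar>(?V {x} - ?W {x}) * ?W {y}\<bar>" by linarith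
    also have "\<dots> \<le> 1 * ?d + ?d * 1"
      unfolding abs_mult
      using close[of "{x}"] close[of "{y}"] void_functional_bounds[OF M] void_functional_bounds[OF N(1)]
      by (intro add_mono mult_mono) auto
    finally have "?V {x} * ?V {y} - ?V {x, y} \<le> 3 * ?d"
      using corr close[of "{x, y}"] by simp
    moreover have "1 / (32 * real m) \<le> ?V {x} * ?V {y} - ?V {x, y}"
      unfolding V by (rule two_point_correlation_gap[OF m])
    ultimately show ?thesis by simp
  qed
  with X show ?thesis by (intro that[of M X]) auto
qed

end

theorem theorem4:
  assumes "locally_compact_space (euclidean :: 'a::{t2_space, second_countable_topology} topology)"
    and "\<exists>x y :: 'a. x \<noteq> y"
  shows "\<exists>c\<^sub>1 c\<^sub>2 :: real. 0 < c\<^sub>1 \<and> 0 < c\<^sub>2 \<and>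
    (\<forall>m\<ge>1. c\<^sub>2 / real m \<le> psi TYPE('a) m \<and> psi TYPE('a) m \<le> c\<^sub>1 / real m)"
proof (rule exI[of _ 2], rule exI[of _ "1 / 96"], intro conjI allI impI)
  fix m :: nat assume m: "1 \<le> m"
  obtain x y :: 'a where "x \<noteq> y" using assms(2) by blast
  then obtain M and X :: "'a sample \<Rightarrow> 'a set" where X: "(M, X) \<in> D m"
    and far: "\<And>Y. Y \<in> D_inf \<Longrightarrow> (1 / 96) / real m \<le> d_V (M, X) Y"
    using d_V_two_points_ge[OF assms(1) _ m] by blast
  have random: "random_set M X" using X by (simp add: D_def)
  have D_inf_nonempty: "(D_inf :: 'a rset set) \<noteq> {}"
    using ex_infinitely_divisible_compound_poisson[OF assms(1) random zero_less_one] by blast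
  have upper: "(INF Y \<in> D_inf. d_V Z Y) \<le> 2 / real m" if "Z \<in> D m" for Z :: "'a rset"
    using INF_d_V_le[OF assms(1) m] that by (cases Z) simp
  show "psi TYPE('a) m \<le> 2 / real m"
    unfolding psi_def using X upper by (intro cSUP_least) auto
  have "(1 / 96) / real m \<le> (INF Y \<in> D_inf. d_V (M, X) Y)"
    using D_inf_nonempty far by (rule cINF_greatest)
  also have "\<dots> \<le> psi TYPE('a) m"
    unfolding psi_def using X upper by (intro cSUP_upper bdd_aboveI[of _ "2 / real m"]) auto
  finally show "(1 / 96) / real m \<le> psi TYPE('a) m" .
qed simp_all

end
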